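(* Let $c_{10} = 0.123456789101112131415\ldots$ be the Champernowne constant for base $10$. Then there exists a constant $K_2 > 0$ such that for infinitely many positive integers $N$, $$D(c_{10}, N) > \frac{K_2}{\log N}.$$ In particular, one can take $K_2 = \dfrac{1}{10^3\cdot 3}$.
   Context: The Champernowne constant $c_{10}\in[0,1)$ is the real number whose decimal expansion is the concatenation, in increasing order, of all positive integers written in base $10$: $c_{10}=0.1\,2\,3\,4\,5\,6\,7\,8\,9\,10\,11\,12\,13\ldots$. For a sequence $(x_n)_{n\ge 1}\subset[0,1)$ and a positive integer $N$, the discrepancy of its first $N$ terms is $$D\left((x_n)_{n\ge 1}, N\right)=\sup_{0\le a<b<1}\left|\frac{\#\{n : x_n\in[a,b),\ 1\le n\le N\}}{N}-(b-a)\right|.$$ For $\alpha\in[0,1)$, its discrepancy for base $10$ is $D(\alpha,N)=D\left((10^{n-1}\alpha \bmod 1)_{n\ge 1}, N\right)$, where $y \bmod 1 = y-\lfloor y\rfloor$ denotes the fractional part of $y$. $\log$ denotes the logarithm in base $10$; the inequality is considered for $N\ge 2$. *)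

theory Defs
  imports Complex_Main
begin

text \<open>Most significant digit first, without leading zeros for positive arguments.\<close>

fun decimal_digits :: "nat \<Rightarrow> nat list" where
  "decimal_digits m = (if m < 10 then [m] else decimal_digits (m div 10) @ [m mod 10])"

declare decimal_digits.simps [simp del]

text \<open>
  The digit at position \<open>i\<close> (counted from \<open>0\<close>) of the infinite word obtained by writing
  \<open>1, 2, 3, \<dots>\<close> one after the other. Every integer contributes at least one digit, so the
  finite word written by \<open>1, \<dots>, i + 1\<close> already contains that position.
\<close>

definition champernowne_digit :: "nat \<Rightarrow> nat" where
  "champernowne_digit i = concat (map decimal_digits [1..<i + 2]) ! i"

definition champernowne :: real where
  "champernowne = (\<Sum>i. real (champernowne_digit i) / 10 ^ (i + 1))"

text \<open>Sequences are indexed from \<open>1\<close>; the value at \<open>0\<close> is not used.\<close>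

definition seq_discrepancy :: "(nat \<Rightarrow> real) \<Rightarrow> nat \<Rightarrow> real" where
  "seq_discrepancy x N =
    (SUP (a, b) \<in> {(a, b). 0 \<le> a \<and> a < b \<and> b < 1}.
       \<bar>real (card {n. x n \<in> {a..<b} \<and> 1 \<le> n \<and> n \<le> N}) / real N - (b - a)\<bar>)"

definition discrepancy10 :: "real \<Rightarrow> nat \<Rightarrow> real" where
  "discrepancy10 \<alpha> N = seq_discrepancy (\<lambda>n. frac (10 ^ (n - 1) * \<alpha>)) N"

text \<open>
  The list index, the series and the supremum in the definitions above are well defined.
\<close>

lemma decimal_digits_length: "1 \<le> length (decimal_digits m)"
  by (subst decimal_digits.simps) auto

lemma champernowne_word_length:
  "k \<le> length (concat (map decimal_digits [1..<k + 1]))"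
proof (induction k)
  case (Suc k)
  then show ?case
    using decimal_digits_length[of "Suc k"] by simp
qed simp

lemma champernowne_digit_eq:
  assumes "i < k"
  shows "champernowne_digit i = concat (map decimal_digits [1..<k + 1]) ! i"
proof -
  have "[1..<k + 1] = [1..<i + 2] @ [i + 2..<k + 1]"
    using assms upt_add_eq_append[of 1 "i + 2" "k - Suc i"] by simp
  moreover have "i < length (concat (map decimal_digits [1..<i + 2]))"
    using champernowne_word_length[of "i + 1"] by simp
  ultimately show ?thesis
    by (simp only: champernowne_digit_def map_append concat_append nth_append if_True)
qed

lemma decimal_digits_less_10: "d \<in> set (decimal_digits m) \<Longrightarrow> d < 10"
proof (induction m rule: decimal_digits.induct)
  case (1 m)
  then show ?case
    by (subst (asm) (2) decimal_digits.simps) (auto split: if_splits)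
qed

lemma champernowne_digit_less_10: "champernowne_digit i < 10"
proof -
  have "i < length (concat (map decimal_digits [1..<i + 2]))"
    using champernowne_word_length[of "i + 1"] by simp
  then have "champernowne_digit i \<in> set (concat (map decimal_digits [1..<i + 2]))"
    unfolding champernowne_digit_def by (rule nth_mem)
  then show ?thesis
    using decimal_digits_less_10 by auto
qed

lemma summable_champernowne: "summable (\<lambda>i. real (champernowne_digit i) / 10 ^ (i + 1))"
proof (rule summable_comparison_test')
  show "summable (\<lambda>i. (1 / 10 :: real) ^ i)"
    by (rule summable_geometric) simp
  show "norm (real (champernowne_digit i) / 10 ^ (i + 1)) \<le> (1 / 10) ^ i" for i
    using champernowne_digit_less_10[of i] by (simp add: field_simps)
qed

lemma seq_discrepancy_bdd_above:
  "bdd_above ((\<lambda>(a, b). \<bar>real (card {n. x n \<in> {a..<b} \<and> 1 \<le> n \<and> n \<le> N}) / real N - (b - a)\<bar>)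
     ` {(a, b). 0 \<le> a \<and> a < b \<and> b < (1::real)})"
proof -
  have "\<bar>real (card {n. x n \<in> {a..<b} \<and> 1 \<le> n \<and> n \<le> N}) / real N - (b - a)\<bar> \<le> 1"
    if "0 \<le> a" "a < b" "b < (1::real)" for a b
  proof -
    have "card {n. x n \<in> {a..<b} \<and> 1 \<le> n \<and> n \<le> N} \<le> card {1..N}"
      by (rule card_mono) auto
    then have "real (card {n. x n \<in> {a..<b} \<and> 1 \<le> n \<and> n \<le> N}) / real N \<le> 1"
      by (cases "N = 0") (simp_all add: divide_le_eq_1)
    moreover have "0 \<le> real (card {n. x n \<in> {a..<b} \<and> 1 \<le> n \<and> n \<le> N}) / real N"
      by simp
    ultimately show ?thesis
      using that by linarith
  qed
  then show ?thesis
    by (auto intro!: bdd_aboveI[where M = 1])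
qed

end

theory Submission imports Defs begin

text \<open>
  The digit \<open>1\<close> occurs too often whenever the digit word stops right after the integer
  \<open>2 * 10 ^ k - 1\<close>: among the integers from \<open>10 ^ k\<close> to
  \<open>2 * 10 ^ k - 1\<close> every leading digit is \<open>1\<close>, while all other positions are
  equidistributed; the blocks of shorter integers, whose leading digit is never \<open>0\<close>, have
  slightly too many ones as well. So, of \<open>N\<close> digits, the number of ones exceeds \<open>N / 10\<close> by at
  least \<open>9 / 10 * 10 ^ k\<close> (\<open>ones_excess\<close>). Since \<open>N \<le> (2 * k + 1) * 10 ^ k\<close>
  (\<open>prefix_length_le\<close>), the frequency of ones is too large by at least
  \<open>9 / (10 * (2 * k + 1))\<close>. Now \<open>k \<le> log 10 N\<close>, because \<open>10 ^ k \<le> N\<close>, so this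
  surplus has the order \<open>1 / log 10 N\<close>, with a constant far above \<open>1 / 3000\<close>.

  Excess frequency of a digit bounds the discrepancy from below
  (\<open>digit_frequency_le_discrepancy10\<close>): if the digit at position \<open>n\<close> is \<open>c\<close>, then
  shifting the expansion to that position gives a point of the interval from \<open>c / 10\<close> to
  \<open>(c + 1) / 10\<close>.
\<close>

section \<open>Digit frequencies and discrepancy\<close>

text \<open>
  The right endpoint is kept: it is attained if all digits after position \<open>n\<close> are \<open>9\<close>.
  The bound \<open>c < 9\<close> keeps the shifted expansion below \<open>1\<close>, so that it is its own
  fractional part.
\<close>

lemma frac_shifted_expansion:
  fixes d :: "nat \<Rightarrow> nat"
  assumes digit: "\<And>i. d i < 10" and "d n = c" "c < 9"
  defines "\<alpha> \<equiv> \<Sum>i. real (d i) / 10 ^ (i + 1)"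
  shows "frac (10 ^ n * \<alpha>) \<in> {real c / 10 .. (real c + 1) / 10}"
proof -
  have digit_le: "d i \<le> 9" for i using digit[of i] by simp
  have geom: "(\<lambda>i. 9 / 10 ^ (i + 1) :: real) sums 1"
  proof -
    have "(\<lambda>i. 9 / 10 * (1 / 10) ^ i :: real) sums (9 / 10 * (1 / (1 - 1 / 10)))"
      by (intro sums_mult geometric_sums) simp
    then show ?thesis by (simp add: power_divide)
  qed
  have summ: "summable (\<lambda>i. real (d (i + m)) / 10 ^ (i + 1))" for m
  proof (rule summable_comparison_test')
    show "summable (\<lambda>i. 9 / 10 ^ (i + 1) :: real)" using geom by (rule sums_summable)
    show "norm (real (d (i + m)) / 10 ^ (i + 1)) \<le> 9 / 10 ^ (i + 1)" for i
      using digit_le[of "i + m"] by (simp add: divide_right_mono)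
  qed
  define T where "T m = (\<Sum>i. real (d (i + m)) / 10 ^ (i + 1))" for m
  have T_nonneg: "0 \<le> T m" for m
    unfolding T_def using summ by (intro suminf_nonneg) auto
  have T_le: "T m \<le> 1" for m
  proof -
    have "T m \<le> (\<Sum>i. 9 / 10 ^ (i + 1))"
      unfolding T_def
      by (intro suminf_le summ sums_summable[OF geom] divide_right_mono)
         (use digit_le in simp_all)
    then show ?thesis using sums_unique[OF geom] by simp
  qed
  have T_step: "10 * T m = real (d m) + T (Suc m)" for m
  proof -
    have "T m = (\<Sum>i. real (d (Suc i + m)) / 10 ^ (Suc i + 1)) + real (d m) / 10"
      using suminf_split_head[OF summ[of m]] unfolding T_def by simp
    also have "(\<Sum>i. real (d (Suc i + m)) / 10 ^ (Suc i + 1)) = T (Suc m) / 10"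
      using suminf_divide[OF summ[of "Suc m"], of 10] unfolding T_def by (simp add: mult.commute)
    finally show ?thesis by simp
  qed
  have shift: "\<exists>z::int. 10 ^ m * \<alpha> = of_int z + T m" for m
  proof (induction m)
    case 0
    have "10 ^ 0 * \<alpha> = of_int 0 + T 0" unfolding \<alpha>_def T_def by simp
    then show ?case by blast
  next
    case (Suc m)
    then obtain z :: int where "10 ^ m * \<alpha> = of_int z + T m" by blast
    then have "10 ^ Suc m * \<alpha> = of_int (10 * z + int (d m)) + T (Suc m)"
      using T_step[of m] by simp
    then show ?case by blast
  qed
  have bounds: "T n \<in> {real c / 10 .. (real c + 1) / 10}"
    using T_step[of n] T_nonneg[of "Suc n"] T_le[of "Suc n"] assms(2) by simp
  then have "T n < 1" using \<open>c < 9\<close> by simp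
  moreover obtain z :: int where "10 ^ n * \<alpha> = of_int z + T n" using shift by blast
  ultimately have "frac (10 ^ n * \<alpha>) = T n"
    using T_nonneg[of n] by (simp add: frac_unique_iff)
  then show ?thesis using bounds by simp
qed

text \<open>
  The half-open interval with right endpoint \<open>(c + 1) / 10 + e\<close> contains every point whose
  first digit is \<open>c\<close>, whatever follows that digit; letting \<open>e\<close> tend to \<open>0\<close> removes the loss.
\<close>

lemma digit_frequency_le_discrepancy10:
  fixes d :: "nat \<Rightarrow> nat"
  assumes digit: "\<And>i. d i < 10" and "c < 9"
  shows "real (card {i. i < N \<and> d i = c}) / real N - 1 / 10
    \<le> discrepancy10 (\<Sum>i. real (d i) / 10 ^ (i + 1)) N"
proof (rule field_le_epsilon)
  fix e' :: real assume "0 < e'"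
  define e where "e = min e' (1 / 20)"
  define \<alpha> where "\<alpha> = (\<Sum>i. real (d i) / 10 ^ (i + 1))"
  define x where "x = (\<lambda>n. frac (10 ^ (n - 1) * \<alpha>))"
  define a where "a = real c / 10"
  define b where "b = (real c + 1) / 10 + e"
  have e: "0 < e" "e \<le> 1 / 20" "e \<le> e'" using \<open>0 < e'\<close> by (auto simp: e_def)
  have "real c \<le> 8" using \<open>c < 9\<close> by simp
  then have ab: "0 \<le> a" "a < b" "b < 1" using e unfolding a_def b_def by (simp, argo, argo)
  let ?hits = "{n. x n \<in> {a..<b} \<and> 1 \<le> n \<and> n \<le> N}"
  have "card {i. i < N \<and> d i = c} \<le> card ?hits"
  proof (rule card_inj_on_le)
    show "inj_on Suc {i. i < N \<and> d i = c}" by simp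
    show "Suc ` {i. i < N \<and> d i = c} \<subseteq> ?hits"
    proof safe
      fix i assume "i < N" "c = d i"
      then have "frac (10 ^ i * \<alpha>) \<in> {real c / 10 .. (real c + 1) / 10}"
        using frac_shifted_expansion[of d i c] digit \<open>c < 9\<close> unfolding \<alpha>_def by simp
      then show "x (Suc i) \<in> {a..<b}" using e by (simp add: x_def a_def b_def field_simps)
    qed auto
    show "finite ?hits" by (rule finite_subset[of _ "{..N}"]) auto
  qed
  then have "real (card {i. i < N \<and> d i = c}) / real N - (b - a)
      \<le> \<bar>real (card ?hits) / real N - (b - a)\<bar>"
    by (intro order_trans[OF _ abs_ge_self] diff_right_mono divide_right_mono) auto
  also have "\<dots> \<le> seq_discrepancy x N"
    unfolding seq_discrepancy_def
    using cSUP_upper[OF _ seq_discrepancy_bdd_above[of x N], of "(a, b)"] ab by simp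
  finally show "real (card {i. i < N \<and> d i = c}) / real N - 1 / 10
      \<le> discrepancy10 (\<Sum>i. real (d i) / 10 ^ (i + 1)) N + e'"
    using e unfolding discrepancy10_def x_def \<alpha>_def a_def b_def by argo
qed

section \<open>Counting ones in prefixes of the Champernowne word\<close>

definition prefix_word :: "nat \<Rightarrow> nat list" where
  "prefix_word M = concat (map decimal_digits [1..<M])"

lemma prefix_word_1 [simp]: "prefix_word (Suc 0) = []"
  by (simp add: prefix_word_def)

lemma prefix_word_Suc:
  "1 \<le> M \<Longrightarrow> prefix_word (Suc M) = prefix_word M @ decimal_digits M"
  by (simp add: prefix_word_def)

lemma prefix_word_nth:
  assumes "i < length (prefix_word M)"
  shows "prefix_word M ! i = champernowne_digit i"
proof -
  define k where "k = i + M"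
  have "1 \<le> M" using assms by (cases M) (auto simp: prefix_word_def)
  then have "[1..<k + 2] = [1..<M] @ [M..<k + 2]"
    using upt_add_eq_append[of 1 M "k + 2 - M"] by (simp add: k_def add.commute)
  then have "concat (map decimal_digits [1..<k + 2])
      = prefix_word M @ concat (map decimal_digits [M..<k + 2])"
    by (simp only: prefix_word_def map_append concat_append)
  then show ?thesis
    using champernowne_digit_eq[of i "k + 1"] assms by (simp add: k_def nth_append)
qed

lemma card_champernowne_digit:
  "card {i. i < length (prefix_word M) \<and> champernowne_digit i = c} = count_list (prefix_word M) c"
proof -
  have "{i. i < length (prefix_word M) \<and> champernowne_digit i = c}
      = {i. i < length (prefix_word M) \<and> c = prefix_word M ! i}"
    by (auto simp: prefix_word_nth)
  then show ?thesis
    by (simp add: count_list_eq_length_filter length_filter_conv_card)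
qed

lemma decimal_digits_snoc:
  "1 \<le> q \<Longrightarrow> r < 10 \<Longrightarrow> decimal_digits (10 * q + r) = decimal_digits q @ [r]"
  by (subst decimal_digits.simps) simp

lemma prefix_word_add_10:
  assumes "1 \<le> B"
  shows "prefix_word (10 * Suc B) = prefix_word (10 * B)
    @ concat (map (\<lambda>r. decimal_digits B @ [r]) [0..<10])"
proof -
  have "[1..<10 * Suc B] = [1..<10 * B] @ [10 * B..<10 * B + 10]"
    using assms upt_add_eq_append[of 1 "10 * B" 10] by (simp add: add.commute)
  moreover have "[10 * B..<10 * B + 10] = map (\<lambda>r. 10 * B + r) [0..<10]"
    by (rule nth_equalityI) simp_all
  moreover have "map (\<lambda>r. decimal_digits (10 * B + r)) [0..<10]
      = map (\<lambda>r. decimal_digits B @ [r]) [0..<10]"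
    using assms by (intro map_cong) (simp_all add: decimal_digits_snoc)
  ultimately show ?thesis
    by (simp only: prefix_word_def map_append concat_append map_map comp_def)
qed

lemma prefix_word_10: "prefix_word 10 = [1, 2, 3, 4, 5, 6, 7, 8, 9]"
  by (simp add: prefix_word_def upt_rec decimal_digits.simps)

text \<open>
  The integers from \<open>10\<close> to \<open>10 * B - 1\<close> arise from the positive integers below \<open>B\<close>
  by appending each of the ten digits. Hence the length and the number of ones for \<open>10 * B\<close> follow
  from those for \<open>B\<close>. The one-digit integers account for the summand \<open>1\<close> on the
  left here, \<open>9 + 1 = 10\<close> being the case \<open>B = 1\<close>.
\<close>

lemma length_prefix_word_times_10:
  "1 \<le> B \<Longrightarrow> length (prefix_word (10 * B)) + 1 = 10 * length (prefix_word B) + 10 * B"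
proof (induction B rule: dec_induct)
  case base
  then show ?case by (simp add: prefix_word_10)
next
  case (step B)
  then show ?case
    using prefix_word_add_10[of B] by (simp add: prefix_word_Suc upt_rec)
qed

lemma count_ones_prefix_word_times_10:
  "1 \<le> B \<Longrightarrow> count_list (prefix_word (10 * B)) 1 = 10 * count_list (prefix_word B) 1 + B"
proof (induction B rule: dec_induct)
  case base
  then show ?case by (simp add: prefix_word_10)
next
  case (step B)
  then show ?case
    using prefix_word_add_10[of B] by (simp add: prefix_word_Suc upt_rec)
qed

lemma prefix_word_2: "prefix_word 2 = [1]"
  by (simp add: prefix_word_def upt_rec decimal_digits.simps)

lemma prefix_length_le:
  "length (prefix_word (2 * 10 ^ k)) \<le> (2 * k + 1) * 10 ^ k"
proof (induction k)
  case 0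
  then show ?case by (simp add: prefix_word_2)
next
  case (Suc k)
  have "prefix_word (2 * 10 ^ Suc k) = prefix_word (10 * (2 * 10 ^ k))"
    by (simp add: mult.left_commute)
  then show ?case
    using length_prefix_word_times_10[of "2 * 10 ^ k"] Suc by (simp add: algebra_simps)
qed

lemma prefix_length_ge: "10 ^ k \<le> length (prefix_word (2 * 10 ^ k))"
proof -
  have "(10::nat) ^ k \<ge> 1" by simp
  then show ?thesis
    using champernowne_word_length[of "2 * 10 ^ k - 1"] by (simp add: prefix_word_def)
qed

text \<open>
  Appending a uniformly distributed last digit multiplies the surplus of ones, here scaled by
  \<open>10\<close>, by exactly \<open>10\<close> and adds the surplus \<open>1\<close> of the one-digit integers. The
  initial surplus \<open>9\<close> is that of the one-letter word consisting of the digit \<open>1\<close>.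
\<close>

lemma ones_excess:
  "length (prefix_word (2 * 10 ^ k)) + 9 * 10 ^ k \<le> 10 * count_list (prefix_word (2 * 10 ^ k)) 1"
proof (induction k)
  case 0
  then show ?case by (simp add: prefix_word_2)
next
  case (Suc k)
  have "prefix_word (2 * 10 ^ Suc k) = prefix_word (10 * (2 * 10 ^ k))"
    by (simp add: mult.left_commute)
  then show ?case
    using length_prefix_word_times_10[of "2 * 10 ^ k"]
      count_ones_prefix_word_times_10[of "2 * 10 ^ k"] Suc by simp
qed

section \<open>The lower bound\<close>

lemma discrepancy_champernowne_ge:
  defines "N k \<equiv> length (prefix_word (2 * 10 ^ k))"
  shows "9 / (10 * (2 * real k + 1)) \<le> discrepancy10 champernowne (N k)"
proof -
  define C where "C = count_list (prefix_word (2 * 10 ^ k)) 1"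
  have "(10::nat) ^ k > 0" by simp
  then have "N k > 0" using prefix_length_ge[of k] unfolding N_def by linarith
  then have pos: "0 < real (N k)" by simp
  have "real (N k) \<le> real ((2 * k + 1) * 10 ^ k)"
    unfolding N_def using prefix_length_le by (simp only: of_nat_le_iff)
  then have len: "real (N k) \<le> (2 * real k + 1) * 10 ^ k" by (simp add: algebra_simps)
  have "real (N k + 9 * 10 ^ k) \<le> real (10 * C)"
    unfolding N_def C_def using ones_excess by (simp only: of_nat_le_iff)
  then have excess: "9 * 10 ^ k \<le> 10 * real C - real (N k)" by simp
  have "9 / (10 * (2 * real k + 1)) = 9 * 10 ^ k / (10 * ((2 * real k + 1) * 10 ^ k))"
    by simp
  also have "\<dots> \<le> 9 * 10 ^ k / (10 * real (N k))"
    using pos len by (intro divide_left_mono mult_left_mono) auto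
  also have "\<dots> \<le> (10 * real C - real (N k)) / (10 * real (N k))"
    using excess pos by (intro divide_right_mono) auto
  also have "\<dots> = real C / real (N k) - 1 / 10"
    using pos by (simp add: field_simps)
  also have "\<dots> \<le> discrepancy10 champernowne (N k)"
    using digit_frequency_le_discrepancy10[of champernowne_digit 1 "N k"]
      champernowne_digit_less_10
    unfolding champernowne_def N_def C_def by (simp add: card_champernowne_digit)
  finally show ?thesis .
qed

theorem theorem2:
  shows "(\<exists>K\<^sub>2::real. K\<^sub>2 > 0 \<and>
            infinite {N::nat. N \<ge> 2 \<and> discrepancy10 champernowne N > K\<^sub>2 / log 10 (real N)})
       \<and> infinite {N::nat. N \<ge> 2 \<and>
            discrepancy10 champernowne N > (1 / (10 ^ 3 * 3)) / log 10 (real N)}"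
proof -
  let ?S = "{N::nat. N \<ge> 2 \<and>
    discrepancy10 champernowne N > (1 / (10 ^ 3 * 3)) / log 10 (real N)}"
  have "\<exists>N\<ge>m. N \<in> ?S" for m
  proof -
    define k where "k = Suc m"
    define N where "N = length (prefix_word (2 * 10 ^ k))"
    have ge: "10 ^ k \<le> N" unfolding N_def by (rule prefix_length_ge)
    have "k < 10 ^ k" by (rule power_gt_expt) simp
    then have N: "m \<le> N" "2 \<le> N" using ge by (auto simp: k_def)
    have "real (10 ^ k) \<le> real N" using ge by (simp only: of_nat_le_iff)
    then have "10 powr real k \<le> real N" by (simp add: powr_realpow)
    then have "real k \<le> log 10 (real N)" using N by (subst le_log_iff) auto
    then have "(1 / (10 ^ 3 * 3)) / log 10 (real N) \<le> (1 / (10 ^ 3 * 3)) / real k"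
      by (intro divide_left_mono) (auto simp: k_def intro!: mult_pos_pos)
    also have "\<dots> < 9 / (10 * (2 * real k + 1))" by (simp add: k_def field_simps)
    also have "\<dots> \<le> discrepancy10 champernowne N"
      unfolding N_def by (rule discrepancy_champernowne_ge)
    finally show ?thesis using N by blast
  qed
  then have "infinite ?S" by (metis (no_types, lifting) finite_nat_set_iff_bounded leD)
  then show ?thesis by (intro conjI exI[of _ "1 / (10 ^ 3 * 3)"]) simp_all
qed

end
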